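(* Let $F(w)=\frac1n\sum_{i=1}^n f_i(w)$ on $\mathbb{R}^d$ be bounded below and $L$-average-smooth. For SARAH (defined in the context) with inner loop size $m=n$ and a learning rate $\eta$ of order $\frac{1}{L\sqrt{m+1}}$ (that is, $\eta=c/(L\sqrt{m+1})$ for a suitable absolute constant $c>0$), an $\epsilon$-accurate solution is achieved, for a suitable choice of the outer loop size $S$, with total complexity $$\mathcal{O}\left(\frac{\sqrt n}{\epsilon}\vee n\right).$$
   Context: Setting: $f_1,\dots,f_n:\mathbb{R}^d\to\mathbb{R}$ are differentiable and $F=\frac1n\sum_{i=1}^n f_i$ has a finite lower bound $F^*$. $a\vee b=\max\{a,b\}$. $L$-average-smooth: there is a constant $L>0$ with $\frac1n\sum_{i=1}^n\|\nabla f_i(w)-\nabla f_i(w')\|^2\le L^2\|w-w'\|^2$ for all $w,w'\in\mathbb{R}^d$. SARAH algorithm. Parameters: learning rate $\eta>0$, inner loop size $m$ (an integer $\ge 0$), outer loop size $S$ (an integer $\ge 1$), starting point $\tilde w_0$. For $s=1,\dots,S$: set $w_0^{(s)}=\tilde w_{s-1}$, $v_0^{(s)}=\frac1n\sum_{i=1}^n\nabla f_i(w_0^{(s)})$, $w_1^{(s)}=w_0^{(s)}-\eta v_0^{(s)}$; then for $t=1,\dots,m$ sample $i_t$ uniformly at random from $\{1,\dots,n\}$ (independently of everything before) and set $v_t^{(s)}=\nabla f_{i_t}(w_t^{(s)})-\nabla f_{i_t}(w_{t-1}^{(s)})+v_{t-1}^{(s)}$ and $w_{t+1}^{(s)}=w_t^{(s)}-\eta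 v_t^{(s)}$; finally set $\tilde w_s=w_{m+1}^{(s)}$. $\epsilon$-accurate solution ($\epsilon>0$): $\frac{1}{(m+1)S}\sum_{s=1}^S\sum_{t=0}^m\mathbb{E}[\|\nabla F(w_t^{(s)})\|^2]\le\epsilon$; equivalently, an iterate $\bar w$ chosen uniformly at random among all $w_t^{(s)}$, $1\le s\le S$, $0\le t\le m$, satisfies $\mathbb{E}[\|\nabla F(\bar w)\|^2]\le\epsilon$. Total complexity: the total number of component gradient evaluations, $S\cdot(n+2m)$. The $\mathcal{O}$-constant in the total complexity may depend on $L$ and $F(\tilde w_0)-F^*$ but not on $n$ or $\epsilon$. *)

theory Defs
  imports "HOL-Probability.Probability"
begin

text \<open>
  The dimension \<open>d\<close> of \<open>\<real>\<^sup>d\<close> has to be quantified inside the statement (the absolute constants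
  must not depend on it), so it cannot be a type. We therefore work in one fixed inner product
  space, the finitely supported real sequences, and \<open>\<real>\<^sup>d\<close> is its subspace \<open>Rd d\<close> of the
  sequences supported on the first \<open>d\<close> indices.
\<close>

typedef fin_seq = "{x :: nat \<Rightarrow> real. finite {i. x i \<noteq> 0}}"
  morphisms coord Abs_fin_seq
  by (rule exI[of _ "\<lambda>_. 0"]) simp

setup_lifting type_definition_fin_seq

lemma finite_coord_support [simp]: "finite {i. coord x i \<noteq> 0}"
  using coord[of x] by simp

instantiation fin_seq :: real_vector
begin

lift_definition zero_fin_seq :: fin_seq is "\<lambda>_. 0" by simp

lift_definition plus_fin_seq :: "fin_seq \<Rightarrow> fin_seq \<Rightarrow> fin_seq" is "\<lambda>x y i. x i + y i"
proof -
  fix x y :: "nat \<Rightarrow> real"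
  assume "finite {i. x i \<noteq> 0}" "finite {i. y i \<noteq> 0}"
  then show "finite {i. x i + y i \<noteq> 0}"
    by (rule_tac finite_subset[of _ "{i. x i \<noteq> 0} \<union> {i. y i \<noteq> 0}"]) auto
qed

lift_definition minus_fin_seq :: "fin_seq \<Rightarrow> fin_seq \<Rightarrow> fin_seq" is "\<lambda>x y i. x i - y i"
proof -
  fix x y :: "nat \<Rightarrow> real"
  assume "finite {i. x i \<noteq> 0}" "finite {i. y i \<noteq> 0}"
  then show "finite {i. x i - y i \<noteq> 0}"
    by (rule_tac finite_subset[of _ "{i. x i \<noteq> 0} \<union> {i. y i \<noteq> 0}"]) auto
qed

lift_definition uminus_fin_seq :: "fin_seq \<Rightarrow> fin_seq" is "\<lambda>x i. - x i" by simp

lift_definition scaleR_fin_seq :: "real \<Rightarrow> fin_seq \<Rightarrow> fin_seq" is "\<lambda>r x i. r * x i" by simp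

instance
  by standard (transfer; simp add: fun_eq_iff algebra_simps)+

end

instantiation fin_seq :: real_inner
begin

definition inner_fin_seq :: "fin_seq \<Rightarrow> fin_seq \<Rightarrow> real" where
  "inner_fin_seq x y = (\<Sum>i | coord x i \<noteq> 0. coord x i * coord y i)"

definition norm_fin_seq :: "fin_seq \<Rightarrow> real" where
  "norm_fin_seq x = sqrt (x \<bullet> x)"

definition sgn_fin_seq :: "fin_seq \<Rightarrow> fin_seq" where
  "sgn_fin_seq x = x /\<^sub>R norm x"

definition dist_fin_seq :: "fin_seq \<Rightarrow> fin_seq \<Rightarrow> real" where
  "dist_fin_seq x y = norm (x - y)"

definition uniformity_fin_seq :: "(fin_seq \<times> fin_seq) filter" where
  "uniformity_fin_seq = (INF e\<in>{0<..}. principal {(x, y). dist x y < e})"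

definition open_fin_seq :: "fin_seq set \<Rightarrow> bool" where
  "open_fin_seq U = (\<forall>x\<in>U. \<forall>\<^sub>F (x', y) in uniformity. x' = x \<longrightarrow> y \<in> U)"

lemma inner_fin_seq_superset:
  assumes "finite A" "{i. coord x i \<noteq> 0} \<subseteq> A"
  shows "x \<bullet> y = (\<Sum>i\<in>A. coord x i * coord y i)"
  unfolding inner_fin_seq_def by (rule sum.mono_neutral_left) (use assms in auto)

instance
proof
  fix x y z :: fin_seq and r :: real
  show "sgn x = x /\<^sub>R norm x" by (rule sgn_fin_seq_def)
  show "dist x y = norm (x - y)" by (rule dist_fin_seq_def)
  show "uniformity = (INF e\<in>{0<..}. principal {(x, y :: fin_seq). dist x y < e})"
    by (rule uniformity_fin_seq_def)
  show "open U = (\<forall>x\<in>U. \<forall>\<^sub>F (x', y) in uniformity. x' = x \<longrightarrow> y \<in> U)" for U :: "fin_seq set"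
    by (rule open_fin_seq_def)
  show "norm x = sqrt (x \<bullet> x)" by (rule norm_fin_seq_def)
  define A where "A = {i. coord x i \<noteq> 0} \<union> {i. coord y i \<noteq> 0}"
  have A: "finite A" "{i. coord x i \<noteq> 0} \<subseteq> A" "{i. coord y i \<noteq> 0} \<subseteq> A"
    by (auto simp: A_def)
  have plus: "coord (x + y) i = coord x i + coord y i" for i by transfer simp
  have scale: "coord (r *\<^sub>R x) i = r * coord x i" for i by transfer simp
  have xy: "{i. coord (x + y) i \<noteq> 0} \<subseteq> A" by (auto simp: A_def plus)
  have rx: "{i. coord (r *\<^sub>R x) i \<noteq> 0} \<subseteq> A" using A by (auto simp: scale)
  show "x \<bullet> y = y \<bullet> x"
    by (simp add: inner_fin_seq_superset[OF A(1,2)] inner_fin_seq_superset[OF A(1,3)] mult.commute)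
  show "(x + y) \<bullet> z = x \<bullet> z + y \<bullet> z"
    by (simp add: inner_fin_seq_superset[OF A(1,2)] inner_fin_seq_superset[OF A(1,3)]
        inner_fin_seq_superset[OF A(1) xy] plus algebra_simps sum.distrib)
  show "(r *\<^sub>R x) \<bullet> y = r * (x \<bullet> y)"
    by (simp add: inner_fin_seq_superset[OF A(1,2)] inner_fin_seq_superset[OF A(1) rx]
        scale sum_distrib_left mult.assoc)
  show "0 \<le> x \<bullet> x"
    unfolding inner_fin_seq_def by (rule sum_nonneg) simp
  show "x \<bullet> x = 0 \<longleftrightarrow> x = 0"
  proof
    assume "x \<bullet> x = 0"
    then have "\<forall>i\<in>{i. coord x i \<noteq> 0}. coord x i * coord x i = 0"
      unfolding inner_fin_seq_def by (subst (asm) sum_nonneg_eq_0_iff) auto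
    then have "coord x i = 0" for i by auto
    then show "x = 0" by transfer auto
  qed (simp add: inner_fin_seq_def zero_fin_seq.rep_eq)
qed

end

definition Rd :: "nat \<Rightarrow> fin_seq set" where
  "Rd d = {x. \<forall>i\<ge>d. coord x i = 0}"

lemma subspace_Rd: "subspace (Rd d)"
  by (auto simp: subspace_def Rd_def zero_fin_seq.rep_eq plus_fin_seq.rep_eq scaleR_fin_seq.rep_eq)

lemma inner_Rd:
  assumes "x \<in> Rd d"
  shows "x \<bullet> y = (\<Sum>i<d. coord x i * coord y i)"
  by (rule inner_fin_seq_superset) (use assms in \<open>auto simp: Rd_def not_le[symmetric]\<close>)

lemma Rd_isometric_euclidean_space:
  obtains T :: "'a :: euclidean_space \<Rightarrow> fin_seq"
  where "linear T" "\<And>x y. T x \<bullet> T y = x \<bullet> y" "range T = Rd DIM('a)"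
proof -
  obtain b :: "nat \<Rightarrow> 'a" where b: "bij_betw b {..<DIM('a)} Basis"
    using ex_bij_betw_nat_finite[of "Basis :: 'a set"] by (auto simp: atLeast0LessThan)
  define T :: "'a \<Rightarrow> fin_seq" where
    "T x = Abs_fin_seq (\<lambda>i. if i < DIM('a) then x \<bullet> b i else 0)" for x
  have cT: "coord (T x) i = (if i < DIM('a) then x \<bullet> b i else 0)" for x i
    unfolding T_def by (subst Abs_fin_seq_inverse) auto
  have TR: "T x \<in> Rd DIM('a)" for x by (simp add: Rd_def cT)
  have "linear T"
    by (rule linearI; rule coord_inject[THEN iffD1]; rule ext)
      (auto simp: cT plus_fin_seq.rep_eq scaleR_fin_seq.rep_eq inner_add_left)
  moreover have "T x \<bullet> T y = x \<bullet> y" for x y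
  proof -
    have "T x \<bullet> T y = (\<Sum>i<DIM('a). (x \<bullet> b i) * (y \<bullet> b i))"
      by (subst inner_Rd[OF TR]) (simp add: cT)
    also have "\<dots> = (\<Sum>v\<in>Basis. (x \<bullet> v) * (y \<bullet> v))"
      by (rule sum.reindex_bij_betw[OF b])
    finally show ?thesis by (simp only: euclidean_inner[of x y])
  qed
  moreover have "range T = Rd DIM('a)"
  proof (intro equalityI subsetI)
    fix z assume z: "z \<in> Rd DIM('a)"
    define x where "x = (\<Sum>j<DIM('a). coord z j *\<^sub>R b j)"
    have "x \<bullet> b i = coord z i" if i: "i < DIM('a)" for i
    proof -
      have "b j \<bullet> b i = (if j = i then 1 else 0)" if "j < DIM('a)" for j
      proof -
        have "b j \<in> Basis" "b i \<in> Basis" "b j = b i \<longleftrightarrow> j = i"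
          using b i that by (auto simp: bij_betw_def inj_on_def)
        then show ?thesis by (simp add: inner_Basis)
      qed
      then show ?thesis
        using i by (simp add: x_def inner_sum_left if_distrib[of "\<lambda>u. _ * u"] cong: if_cong)
    qed
    then have "T x = z"
      using z by (intro coord_inject[THEN iffD1] ext) (auto simp: cT Rd_def)
    then show "z \<in> range T" by blast
  qed (use TR in auto)
  ultimately show ?thesis by (rule that)
qed

text \<open>
  The gradient at \<open>w \<in> V\<close> of a function on the subspace \<open>V\<close>: the vector of \<open>V\<close> that represents the
  derivative of \<open>f\<close> within \<open>V\<close>. Values of \<open>f\<close> outside \<open>V\<close> are irrelevant. For \<open>V = UNIV\<close>
  this is the \<open>D\<close> with \<open>GDERIV f w :> D\<close>.
\<close>

definition gradient_on :: "'a::real_inner set \<Rightarrow> ('a \<Rightarrow> real) \<Rightarrow> 'a \<Rightarrow> 'a" where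
  "gradient_on V f w = (THE D. D \<in> V \<and> (f has_derivative (\<lambda>h. h \<bullet> D)) (at w within V))"

definition average :: "nat \<Rightarrow> (nat \<Rightarrow> 'a \<Rightarrow> 'b) \<Rightarrow> 'a \<Rightarrow> 'b::real_vector" where
  "average n g w = (1 / real n) *\<^sub>R (\<Sum>i=1..n. g i w)"

definition average_smooth_on ::
    "'a::real_inner set \<Rightarrow> nat \<Rightarrow> (nat \<Rightarrow> 'a \<Rightarrow> real) \<Rightarrow> real \<Rightarrow> bool" where
  "average_smooth_on V n f L \<longleftrightarrow> (\<forall>w\<in>V. \<forall>w'\<in>V.
     (1 / real n) * (\<Sum>i=1..n. (norm (gradient_on V (f i) w - gradient_on V (f i) w'))\<^sup>2)
       \<le> L\<^sup>2 * (norm (w - w'))\<^sup>2)"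

text \<open>
  One inner loop of SARAH, started in \<open>w\<^sub>0\<close>: \<open>g i\<close> is the gradient of the \<open>i\<close>-th component and
  \<open>\<iota> t\<close> is the index sampled in step \<open>t \<ge> 1\<close>.
\<close>

fun inner_w inner_v ::
    "nat \<Rightarrow> (nat \<Rightarrow> 'a \<Rightarrow> 'a::real_vector) \<Rightarrow> real \<Rightarrow> 'a \<Rightarrow> (nat \<Rightarrow> nat) \<Rightarrow> nat \<Rightarrow> 'a" where
  "inner_w n g \<eta> w\<^sub>0 \<iota> 0 = w\<^sub>0"
| "inner_w n g \<eta> w\<^sub>0 \<iota> (Suc t) = inner_w n g \<eta> w\<^sub>0 \<iota> t - \<eta> *\<^sub>R inner_v n g \<eta> w\<^sub>0 \<iota> t"
| "inner_v n g \<eta> w\<^sub>0 \<iota> 0 = average n g w\<^sub>0"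
| "inner_v n g \<eta> w\<^sub>0 \<iota> (Suc t) =
     g (\<iota> (Suc t)) (inner_w n g \<eta> w\<^sub>0 \<iota> (Suc t)) - g (\<iota> (Suc t)) (inner_w n g \<eta> w\<^sub>0 \<iota> t)
       + inner_v n g \<eta> w\<^sub>0 \<iota> t"

text \<open>
  \<open>\<omega> (s, t)\<close> is the index sampled in step \<open>t\<close> of outer iteration \<open>s\<close>. \<open>sarah_outer \<dots> s\<close> is the outer
  iterate with index \<open>s\<close>, and \<open>sarah_w \<dots> s t\<close> (used for \<open>s \<ge> 1\<close>) is the iterate \<open>w\<^sub>t\<^sup>(\<^sup>s\<^sup>)\<close>.
\<close>

fun sarah_outer ::
    "nat \<Rightarrow> (nat \<Rightarrow> 'a \<Rightarrow> 'a::real_vector) \<Rightarrow> real \<Rightarrow> nat \<Rightarrow> 'a \<Rightarrow> (nat \<times> nat \<Rightarrow> nat) \<Rightarrow> nat \<Rightarrow> 'a" where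
  "sarah_outer n g \<eta> m w0 \<omega> 0 = w0"
| "sarah_outer n g \<eta> m w0 \<omega> (Suc s) =
     inner_w n g \<eta> (sarah_outer n g \<eta> m w0 \<omega> s) (\<lambda>t. \<omega> (Suc s, t)) (m + 1)"

definition sarah_w ::
    "nat \<Rightarrow> (nat \<Rightarrow> 'a \<Rightarrow> 'a::real_vector) \<Rightarrow> real \<Rightarrow> nat \<Rightarrow> 'a \<Rightarrow> (nat \<times> nat \<Rightarrow> nat) \<Rightarrow> nat \<Rightarrow> nat \<Rightarrow> 'a" where
  "sarah_w n g \<eta> m w0 \<omega> s t =
     inner_w n g \<eta> (sarah_outer n g \<eta> m w0 \<omega> (s - 1)) (\<lambda>t. \<omega> (s, t)) t"

text \<open>The law of the sampled indices: independent, each uniform on \<open>{1..n}\<close>.\<close>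

definition sarah_samples :: "nat \<Rightarrow> nat \<Rightarrow> nat \<Rightarrow> (nat \<times> nat \<Rightarrow> nat) pmf" where
  "sarah_samples n m S = Pi_pmf ({1..S} \<times> {1..m}) 0 (\<lambda>_. pmf_of_set {1..n})"

definition sarah_accurate ::
    "'a::real_inner set \<Rightarrow> nat \<Rightarrow> (nat \<Rightarrow> 'a \<Rightarrow> real) \<Rightarrow> real \<Rightarrow> nat \<Rightarrow> nat \<Rightarrow> 'a \<Rightarrow> real \<Rightarrow> bool" where
  "sarah_accurate V n f \<eta> m S w0 \<epsilon> \<longleftrightarrow>
     1 / (real (m + 1) * real S) *
       (\<Sum>s=1..S. \<Sum>t=0..m. measure_pmf.expectation (sarah_samples n m S)
          (\<lambda>\<omega>. (norm (gradient_on V (average n f)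
             (sarah_w n (\<lambda>i. gradient_on V (f i)) \<eta> m w0 \<omega> s t)))\<^sup>2)) \<le> \<epsilon>"

text \<open>
  Component gradient evaluations: per outer iteration, \<open>n\<close> for the full gradient and two for each
  of the \<open>m\<close> inner steps.
\<close>

definition sarah_complexity :: "nat \<Rightarrow> nat \<Rightarrow> nat \<Rightarrow> nat" where
  "sarah_complexity n m S = S * (n + 2 * m)"

end

theory Submission
  imports Defs
begin

text \<open>
  Conditionally on the past, the error \<open>v\<^sub>t - \<nabla>F(w\<^sub>t)\<close> of the SARAH estimator changes by a centred
  term, so its expected square grows by at most \<open>L\<^sup>2\<eta>\<^sup>2\<parallel>v\<^sub>t\<parallel>\<^sup>2\<close> per step. By \<open>L\<close>-smoothness of \<open>F\<close>, a step
  decreases \<open>F\<close> by at least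
  \<open>\<eta>/2 (\<parallel>\<nabla>F(w\<^sub>t)\<parallel>\<^sup>2 - \<parallel>v\<^sub>t - \<nabla>F(w\<^sub>t)\<parallel>\<^sup>2 + (1 - L\<eta>) \<parallel>v\<^sub>t\<parallel>\<^sup>2)\<close>.
  Hence the potential \<open>F(w\<^sub>t) + \<eta>/2 (m + 1 - t) \<parallel>v\<^sub>t - \<nabla>F(w\<^sub>t)\<parallel>\<^sup>2\<close> decreases in expectation by at least
  \<open>\<eta>/2 \<parallel>\<nabla>F(w\<^sub>t)\<parallel>\<^sup>2\<close> as soon as \<open>m L\<^sup>2\<eta>\<^sup>2 \<le> 1 - L\<eta>\<close>, which \<open>\<eta> = 1 / (2 L \<surd>(m + 1))\<close> satisfies. At both ends of
  an inner loop the potential is just \<open>F\<close>, so the decreases telescope over all outer iterations.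
\<close>

section \<open>Gradients on a subspace\<close>

text \<open>A line through a point of \<open>V\<close> in a direction of \<open>V\<close> stays in
  \<open>V\<close>, so the derivative within \<open>V\<close> restricts to it and the chain rule
  applies. Uniqueness of gradients and the descent inequality both reduce to one real variable this
  way.\<close>

lemma has_real_derivative_along_line:
  fixes f :: "'a::real_inner \<Rightarrow> real"
  assumes V: "subspace V" "w \<in> V" "h \<in> V"
    and D: "(f has_derivative (\<lambda>k. k \<bullet> D)) (at (w + t *\<^sub>R h) within V)"
  shows "((\<lambda>t. f (w + t *\<^sub>R h)) has_real_derivative h \<bullet> D) (at t)"
proof -
  have line: "((\<lambda>t. w + t *\<^sub>R h) has_derivative (\<lambda>s. s *\<^sub>R h)) (at t)"
    by (auto intro!: derivative_eq_intros)
  have "range (\<lambda>t. w + t *\<^sub>R h) \<subseteq> V"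
    using V by (auto intro!: subspace_add subspace_scale)
  then have "(f has_derivative (\<lambda>k. k \<bullet> D)) (at (w + t *\<^sub>R h) within range (\<lambda>t. w + t *\<^sub>R h))"
    using D has_derivative_subset by blast
  from has_derivative_in_compose[OF line this] show ?thesis
    by (simp add: has_field_derivative_def mult.commute[of _ "h \<bullet> D"])
qed

text \<open>Two representing vectors have the same inner products with every direction of
  \<open>V\<close>. Their difference is such a direction, so it is orthogonal to itself.\<close>

lemma gradient_on_eqI:
  fixes f :: "'a::real_inner \<Rightarrow> real"
  assumes V: "subspace V" "w \<in> V" and "D \<in> V"
    and D: "(f has_derivative (\<lambda>h. h \<bullet> D)) (at w within V)"
  shows "gradient_on V f w = D"
  unfolding gradient_on_def
proof (rule the_equality)
  fix D' assume D': "D' \<in> V \<and> (f has_derivative (\<lambda>h. h \<bullet> D')) (at w within V)"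
  have "D' - D \<in> V" using V D' \<open>D \<in> V\<close> by (simp add: subspace_diff)
  then have "(D' - D) \<bullet> D' = (D' - D) \<bullet> D"
    using has_real_derivative_along_line[of V w "D' - D" f D' 0]
      has_real_derivative_along_line[of V w "D' - D" f D 0] V D D' DERIV_unique
    by (metis add.right_neutral scaleR_zero_left)
  then have "(D' - D) \<bullet> (D' - D) = 0" by (simp add: inner_diff_right)
  then show "D' = D" by simp
qed (use assms in auto)

text \<open>Riesz representation in finite dimension: the coordinates of the gradient are the values
  of the derivative on the unit vectors.\<close>

lemma Rd_has_gradient:
  assumes w: "w \<in> Rd d" and f: "f differentiable (at w within Rd d)"
  shows "gradient_on (Rd d) f w \<in> Rd d"
    and "(f has_derivative (\<lambda>h. h \<bullet> gradient_on (Rd d) f w)) (at w within Rd d)"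
proof -
  obtain f' where f': "(f has_derivative f') (at w within Rd d)"
    using f by (auto simp: differentiable_def)
  interpret f': bounded_linear f' using f' by (rule has_derivative_bounded_linear)
  define e where "e i = Abs_fin_seq (\<lambda>j. if j = i then 1 else 0)" for i
  have ce: "coord (e i) j = (if j = i then 1 else 0)" for i j
    unfolding e_def by (subst Abs_fin_seq_inverse) auto
  define D where "D = Abs_fin_seq (\<lambda>i. if i < d then f' (e i) else 0)"
  have cD: "coord D i = (if i < d then f' (e i) else 0)" for i
    unfolding D_def by (subst Abs_fin_seq_inverse) auto
  have D: "D \<in> Rd d" by (simp add: Rd_def cD)
  have eq: "f' x = x \<bullet> D" if x: "x \<in> Rd d" for x
  proof -
    have csum: "coord (\<Sum>i\<in>A. z i) j = (\<Sum>i\<in>A. coord (z i) j)" for A :: "nat set" and z j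
      by (induction A rule: infinite_finite_induct)
        (auto simp: zero_fin_seq.rep_eq plus_fin_seq.rep_eq)
    have "x = (\<Sum>i<d. coord x i *\<^sub>R e i)"
      using x by (intro coord_inject[THEN iffD1] ext)
        (auto simp: csum scaleR_fin_seq.rep_eq ce Rd_def if_distrib[of "\<lambda>u. _ * u"] cong: if_cong)
    then have "f' x = f' (\<Sum>i<d. coord x i *\<^sub>R e i)" by simp
    also have "\<dots> = (\<Sum>i<d. coord x i * f' (e i))" by (simp add: f'.sum f'.scaleR)
    also have "\<dots> = x \<bullet> D" by (simp add: inner_Rd[OF x] cD)
    finally show ?thesis .
  qed
  have fD: "(f has_derivative (\<lambda>h. h \<bullet> D)) (at w within Rd d)"
    unfolding has_derivative_within
  proof (intro conjI bounded_linear_inner_left)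
    show "((\<lambda>y. (1 / norm (y - w)) *\<^sub>R (f y - (f w + (y - w) \<bullet> D))) \<longlongrightarrow> 0) (at w within Rd d)"
    \<comment> \<open>\<open>f'\<close> and the inner product with \<open>D\<close> need not agree
      off \<open>Rd d\<close>, but the limit only sees increments \<open>y - w\<close> in
      \<open>Rd d\<close>. The radius 1 is arbitrary.\<close>
    proof (rule Lim_transform_within[where d = 1])
      show "((\<lambda>y. (1 / norm (y - w)) *\<^sub>R (f y - (f w + f' (y - w)))) \<longlongrightarrow> 0) (at w within Rd d)"
        using f' by (simp add: has_derivative_within)
    qed (use w in \<open>auto simp: eq subspace_diff[OF subspace_Rd]\<close>)
  qed
  with gradient_on_eqI[OF subspace_Rd w D fD] D
  show "gradient_on (Rd d) f w \<in> Rd d"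
    and "(f has_derivative (\<lambda>h. h \<bullet> gradient_on (Rd d) f w)) (at w within Rd d)"
    by simp_all
qed

lemma average_in_subspace:
  assumes "subspace V" "\<And>i. i \<in> {1..n} \<Longrightarrow> g i w \<in> V"
  shows "average n g w \<in> V"
  unfolding average_def using assms by (intro subspace_scale subspace_sum) auto

lemma average_has_derivative:
  fixes f :: "nat \<Rightarrow> 'a::real_inner \<Rightarrow> real"
  assumes "\<And>i. i \<in> {1..n} \<Longrightarrow> (f i has_derivative (\<lambda>h. h \<bullet> g i w)) (at w within V)"
  shows "(average n f has_derivative (\<lambda>h. h \<bullet> average n g w)) (at w within V)"
proof -
  have "((\<lambda>x. (1 / real n) *\<^sub>R (\<Sum>i=1..n. f i x)) has_derivative
      (\<lambda>h. (1 / real n) *\<^sub>R (\<Sum>i=1..n. h \<bullet> g i w))) (at w within V)"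
    by (intro has_derivative_scaleR_right has_derivative_sum assms)
  then show ?thesis
    by (simp add: average_def[abs_def] inner_sum_right)
qed

lemma descent_inequality:
  fixes F :: "'a::real_inner \<Rightarrow> real"
  assumes V: "subspace V" "w \<in> V" "u \<in> V"
    and D: "\<And>x. x \<in> V \<Longrightarrow> (F has_derivative (\<lambda>h. h \<bullet> G x)) (at x within V)"
    and lip: "\<And>x y. x \<in> V \<Longrightarrow> y \<in> V \<Longrightarrow> norm (G x - G y) \<le> L * norm (x - y)"
  shows "F u \<le> F w + (u - w) \<bullet> G w + L / 2 * (norm (u - w))\<^sup>2"
proof -
  define h where "h = u - w"
  have h: "h \<in> V" using V by (simp add: h_def subspace_diff)
  have line: "w + t *\<^sub>R h \<in> V" for t using V h by (intro subspace_add subspace_scale)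
  \<comment> \<open>The claim reads \<open>\<psi> 1 \<le> \<psi> 0\<close>. By Cauchy-Schwarz and
    the Lipschitz bound, the derivative of \<open>\<psi>\<close> is nonpositive on the unit
    interval.\<close>
  define \<psi> where "\<psi> t = F (w + t *\<^sub>R h) - t * (h \<bullet> G w) - L / 2 * t\<^sup>2 * (norm h)\<^sup>2" for t
  have "\<psi> 1 \<le> \<psi> 0"
  proof (rule DERIV_nonpos_imp_nonincreasing[of 0 1 \<psi>])
    fix t :: real assume t: "0 \<le> t" "t \<le> 1"
    have "(\<psi> has_real_derivative h \<bullet> G (w + t *\<^sub>R h) - h \<bullet> G w - L * t * (norm h)\<^sup>2) (at t)"
      unfolding \<psi>_def
      by (rule derivative_eq_intros has_real_derivative_along_line[OF V(1,2) h D[OF line]]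
          refl | simp)+
    moreover have "h \<bullet> G (w + t *\<^sub>R h) - h \<bullet> G w \<le> L * t * (norm h)\<^sup>2"
    proof -
      have "h \<bullet> G (w + t *\<^sub>R h) - h \<bullet> G w \<le> norm h * norm (G (w + t *\<^sub>R h) - G w)"
        by (metis inner_diff_right norm_cauchy_schwarz)
      also have "\<dots> \<le> norm h * (L * (t * norm h))"
        using lip[OF line[of t] V(2)] t by (intro mult_left_mono) auto
      finally show ?thesis by (simp add: power2_eq_square mult_ac)
    qed
    ultimately show "\<exists>y. (\<psi> has_real_derivative y) (at t) \<and> y \<le> 0" by fastforce
  qed simp
  then show ?thesis by (simp add: \<psi>_def h_def)
qed

section \<open>Averages and resampling\<close>

text \<open>Subtracting the mean centres \<open>\<xi>\<close>, so the cross term with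
  \<open>e\<close> averages to zero, and a variance is at most the second moment.\<close>

lemma average_variance_le:
  fixes \<xi> :: "nat \<Rightarrow> 'a::real_inner"
  assumes n: "n \<ge> 1"
  shows "(\<Sum>i=1..n. (norm (e + \<xi> i - (1 / real n) *\<^sub>R (\<Sum>j=1..n. \<xi> j)))\<^sup>2) / real n
    \<le> (norm e)\<^sup>2 + (\<Sum>i=1..n. (norm (\<xi> i))\<^sup>2) / real n"
proof -
  define b where "b = (1 / real n) *\<^sub>R (\<Sum>j=1..n. \<xi> j)"
  have b: "(\<Sum>i=1..n. \<xi> i) = real n *\<^sub>R b" using n by (simp add: b_def)
  have "(norm (e + \<xi> i - b))\<^sup>2
      = (norm e)\<^sup>2 - 2 * (e \<bullet> b) + b \<bullet> b + (norm (\<xi> i))\<^sup>2 + 2 * ((e - b) \<bullet> \<xi> i)" for i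
    by (simp add: power2_norm_eq_inner algebra_simps inner_commute)
  then have "(\<Sum>i=1..n. (norm (e + \<xi> i - b))\<^sup>2)
      = real n * ((norm e)\<^sup>2 - 2 * (e \<bullet> b) + b \<bullet> b) + (\<Sum>i=1..n. (norm (\<xi> i))\<^sup>2)
        + 2 * ((e - b) \<bullet> (\<Sum>i=1..n. \<xi> i))"
    by (simp add: sum.distrib sum_distrib_left inner_sum_right)
  also have "\<dots> = real n * (norm e)\<^sup>2 + (\<Sum>i=1..n. (norm (\<xi> i))\<^sup>2) - real n * (b \<bullet> b)"
    unfolding b by (simp add: algebra_simps)
  also have "\<dots> \<le> real n * (norm e)\<^sup>2 + (\<Sum>i=1..n. (norm (\<xi> i))\<^sup>2)" by simp
  finally show ?thesis
    using n unfolding b_def[symmetric] by (simp add: divide_simps mult.commute)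
qed

text \<open>Jensen's inequality, obtained from nonnegativity of the variance. It turns average
  smoothness into a Lipschitz bound for the gradient of the average.\<close>

lemma norm_average_le:
  fixes x :: "nat \<Rightarrow> 'a::real_inner"
  shows "(norm ((1 / real n) *\<^sub>R (\<Sum>i=1..n. x i)))\<^sup>2 \<le> (1 / real n) * (\<Sum>i=1..n. (norm (x i))\<^sup>2)"
proof (cases "n = 0")
  case False
  define b where "b = (1 / real n) *\<^sub>R (\<Sum>i=1..n. x i)"
  have b: "(\<Sum>i=1..n. x i) = real n *\<^sub>R b" using False by (simp add: b_def)
  have "0 \<le> (\<Sum>i=1..n. (norm (x i - b))\<^sup>2)" by (rule sum_nonneg) simp
  also have "\<dots> = (\<Sum>i=1..n. (norm (x i))\<^sup>2 + b \<bullet> b - 2 * (b \<bullet> x i))"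
    by (rule sum.cong) (simp_all add: power2_norm_eq_inner algebra_simps inner_commute)
  also have "\<dots> = (\<Sum>i=1..n. (norm (x i))\<^sup>2) + real n * (b \<bullet> b) - 2 * (b \<bullet> (\<Sum>i=1..n. x i))"
    by (simp add: sum.distrib sum_subtractf sum_distrib_left inner_sum_right)
  also have "\<dots> = (\<Sum>i=1..n. (norm (x i))\<^sup>2) - real n * (norm b)\<^sup>2"
    unfolding b by (simp add: power2_norm_eq_inner)
  finally show ?thesis
    using False unfolding b_def[symmetric] by (simp add: field_simps)
qed simp

text \<open>
  Redrawing one coordinate does not change a product law; this replaces conditioning on the past.
\<close>

lemma Pi_pmf_resample:
  assumes "finite A" "x \<in> A"
  shows "Pi_pmf A dflt p \<bind> (\<lambda>\<sigma>. map_pmf (\<lambda>i. \<sigma>(x := i)) (p x)) = Pi_pmf A dflt p"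
proof -
  have "Pi_pmf A dflt p = Pi_pmf (insert x (A - {x})) dflt p"
    using assms by (simp add: insert_absorb)
  also have "\<dots> = p x \<bind> (\<lambda>y. Pi_pmf (A - {x}) dflt p \<bind> (\<lambda>f. return_pmf (f(x := y))))"
    using assms by (intro Pi_pmf_insert') auto
  finally have eq: "Pi_pmf A dflt p = \<dots>" .
  show ?thesis
    unfolding eq map_pmf_def
    by (simp add: bind_assoc_pmf bind_return_pmf bind_pmf_const bind_commute_pmf[of "p x"])
qed

lemma expectation_Pi_pmf_resample:
  fixes h :: "_ \<Rightarrow> real"
  assumes A: "finite A" "x \<in> A" and fin: "\<And>y. y \<in> A \<Longrightarrow> finite (set_pmf (p y))"
  shows "measure_pmf.expectation (Pi_pmf A dflt p) h =
    measure_pmf.expectation (Pi_pmf A dflt p)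
      (\<lambda>\<sigma>. measure_pmf.expectation (p x) (\<lambda>i. h (\<sigma>(x := i))))"
proof -
  have finA: "finite (set_pmf (Pi_pmf A dflt p))"
    using A fin by (simp add: set_Pi_pmf finite_PiE_dflt)
  have "measure_pmf.expectation (Pi_pmf A dflt p) h =
      measure_pmf.expectation
        (Pi_pmf A dflt p \<bind> (\<lambda>\<sigma>. map_pmf (\<lambda>i. \<sigma>(x := i)) (p x))) h"
    by (simp add: Pi_pmf_resample[OF A])
  also have "\<dots> = (\<Sum>\<sigma>\<in>set_pmf (Pi_pmf A dflt p). pmf (Pi_pmf A dflt p) \<sigma> *\<^sub>R
      measure_pmf.expectation (map_pmf (\<lambda>i. \<sigma>(x := i)) (p x)) h)"
    using A fin by (intro pmf_expectation_bind finA) auto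
  also have "\<dots> = measure_pmf.expectation (Pi_pmf A dflt p)
      (\<lambda>\<sigma>. measure_pmf.expectation (p x) (\<lambda>i. h (\<sigma>(x := i))))"
    by (subst integral_measure_pmf[OF finA]) (auto simp: set_pmf_iff)
  finally show ?thesis .
qed

section \<open>Expectations under the law of the sampled indices\<close>

lemma finite_set_sarah_samples [simp]: "n \<ge> 1 \<Longrightarrow> finite (set_pmf (sarah_samples n m S))"
  by (auto simp: sarah_samples_def set_Pi_pmf set_pmf_of_set intro!: finite_PiE_dflt)

lemma integrable_sarah_samples [simp]:
  "n \<ge> 1 \<Longrightarrow> integrable (measure_pmf (sarah_samples n m S)) (h :: _ \<Rightarrow> real)"
  by (rule integrable_measure_pmf_finite) simp

lemma set_sarah_samplesD:
  assumes "n \<ge> 1" "\<sigma> \<in> set_pmf (sarah_samples n m S)" "s \<in> {1..S}" "t \<in> {1..m}"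
  shows "\<sigma> (s, t) \<in> {1..n}"
  using assms by (auto simp: sarah_samples_def set_Pi_pmf set_pmf_of_set PiE_dflt_def)

lemma expectation_sarah_samples_mono:
  fixes h k :: "_ \<Rightarrow> real"
  assumes "n \<ge> 1" "\<And>\<sigma>. \<sigma> \<in> set_pmf (sarah_samples n m S) \<Longrightarrow> h \<sigma> \<le> k \<sigma>"
  shows "measure_pmf.expectation (sarah_samples n m S) h
    \<le> measure_pmf.expectation (sarah_samples n m S) k"
  using assms by (intro integral_mono_AE) (auto simp: AE_measure_pmf_iff)

lemma expectation_sarah_samples_resample:
  fixes h :: "_ \<Rightarrow> real"
  assumes "n \<ge> 1" "s \<in> {1..S}" "t \<in> {1..m}"
  shows "measure_pmf.expectation (sarah_samples n m S) h =
    measure_pmf.expectation (sarah_samples n m S)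
      (\<lambda>\<sigma>. (\<Sum>i=1..n. h (\<sigma>((s, t) := i))) / real n)"
proof -
  have "measure_pmf.expectation (pmf_of_set {1..n}) k = (\<Sum>i=1..n. k i) / real n"
    for k :: "nat \<Rightarrow> real"
    using assms by (subst integral_pmf_of_set) auto
  then show ?thesis
    unfolding sarah_samples_def using assms
    by (subst expectation_Pi_pmf_resample[where x = "(s, t)"]) (auto simp: set_pmf_of_set)
qed


section \<open>Descent of SARAH\<close>

definition sarah_v ::
    "nat \<Rightarrow> (nat \<Rightarrow> 'a \<Rightarrow> 'a::real_vector) \<Rightarrow> real \<Rightarrow> nat \<Rightarrow> 'a \<Rightarrow> (nat \<times> nat \<Rightarrow> nat) \<Rightarrow> nat \<Rightarrow> nat \<Rightarrow> 'a" where
  "sarah_v n g \<eta> m w0 \<sigma> s t =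
     inner_v n g \<eta> (sarah_outer n g \<eta> m w0 \<sigma> (s - 1)) (\<lambda>t. \<sigma> (s, t)) t"

lemma inner_cong:
  assumes "\<And>j. 1 \<le> j \<Longrightarrow> j \<le> t \<Longrightarrow> \<iota> j = \<iota>' j"
  shows "inner_w n g \<eta> x \<iota> t = inner_w n g \<eta> x \<iota>' t \<and> inner_v n g \<eta> x \<iota> t = inner_v n g \<eta> x \<iota>' t"
  using assms by (induction t) auto

lemma sarah_outer_cong:
  assumes "\<And>r t. r \<le> s \<Longrightarrow> \<sigma> (r, t) = \<sigma>' (r, t)"
  shows "sarah_outer n g \<eta> m w0 \<sigma> s = sarah_outer n g \<eta> m w0 \<sigma>' s"
  using assms
proof (induction s)
  case (Suc s)
  then have "sarah_outer n g \<eta> m w0 \<sigma> s = sarah_outer n g \<eta> m w0 \<sigma>' s" by simp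
  moreover have "(\<lambda>t. \<sigma> (Suc s, t)) = (\<lambda>t. \<sigma>' (Suc s, t))" using Suc.prems by simp
  ultimately show ?case by (simp only: sarah_outer.simps)
qed simp

text \<open>Adaptedness: an index drawn in a later step cannot influence the current iterate and
  estimator. With resampling, this plays the role of conditional expectation given the past.\<close>

lemma sarah_fun_upd:
  assumes "s \<ge> 1" "t < t'"
  shows "sarah_w n g \<eta> m w0 (\<sigma>((s, t') := i)) s t = sarah_w n g \<eta> m w0 \<sigma> s t"
    and "sarah_v n g \<eta> m w0 (\<sigma>((s, t') := i)) s t = sarah_v n g \<eta> m w0 \<sigma> s t"
proof -
  have "sarah_outer n g \<eta> m w0 (\<sigma>((s, t') := i)) (s - 1) = sarah_outer n g \<eta> m w0 \<sigma> (s - 1)"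
    using assms by (intro sarah_outer_cong) auto
  moreover have "inner_w n g \<eta> x (\<lambda>t. (\<sigma>((s, t') := i)) (s, t)) t = inner_w n g \<eta> x (\<lambda>t. \<sigma> (s, t)) t"
    "inner_v n g \<eta> x (\<lambda>t. (\<sigma>((s, t') := i)) (s, t)) t = inner_v n g \<eta> x (\<lambda>t. \<sigma> (s, t)) t" for x
    using assms inner_cong[of t "\<lambda>t. (\<sigma>((s, t') := i)) (s, t)" "\<lambda>t. \<sigma> (s, t)"] by auto
  ultimately show "sarah_w n g \<eta> m w0 (\<sigma>((s, t') := i)) s t = sarah_w n g \<eta> m w0 \<sigma> s t"
    "sarah_v n g \<eta> m w0 (\<sigma>((s, t') := i)) s t = sarah_v n g \<eta> m w0 \<sigma> s t"
    unfolding sarah_w_def sarah_v_def by (simp_all only:)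
qed

text \<open>Derivatives enter the analysis only through \<open>descent\<close>. The condition
  \<open>step_size\<close> is what lets the negative multiple of the squared norm of
  \<open>v\<close> absorb the accumulated growth of the estimation error.\<close>

locale sarah =
  fixes V :: "'a::real_inner set" and n m S :: nat and F :: "'a \<Rightarrow> real"
    and g :: "nat \<Rightarrow> 'a \<Rightarrow> 'a" and L \<eta> :: real and w0 :: 'a
  assumes V: "subspace V" and n: "n \<ge> 1" and w0: "w0 \<in> V"
    and g: "\<And>i w. i \<in> {1..n} \<Longrightarrow> w \<in> V \<Longrightarrow> g i w \<in> V"
    and descent: "\<And>w u. w \<in> V \<Longrightarrow> u \<in> V \<Longrightarrow>
      F u \<le> F w + (u - w) \<bullet> average n g w + L / 2 * (norm (u - w))\<^sup>2"
    and smooth: "\<And>w u. w \<in> V \<Longrightarrow> u \<in> V \<Longrightarrow>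
      (1 / real n) * (\<Sum>i=1..n. (norm (g i w - g i u))\<^sup>2) \<le> L\<^sup>2 * (norm (w - u))\<^sup>2"
    and \<eta>: "\<eta> > 0" and step_size: "real m * (L\<^sup>2 * \<eta>\<^sup>2) \<le> 1 - L * \<eta>"
begin

abbreviation "G \<equiv> average n g"
abbreviation "E \<equiv> measure_pmf.expectation (sarah_samples n m S)"
abbreviation "w \<equiv> sarah_w n g \<eta> m w0"
abbreviation "v \<equiv> sarah_v n g \<eta> m w0"

section \<open>Invariance of the subspace under the iteration\<close>

lemma G_in_V: "x \<in> V \<Longrightarrow> G x \<in> V"
  using V g by (intro average_in_subspace)

lemma inner_in_V:
  assumes "\<And>j. 1 \<le> j \<Longrightarrow> j \<le> t \<Longrightarrow> \<iota> j \<in> {1..n}" "x \<in> V"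
  shows "inner_w n g \<eta> x \<iota> t \<in> V \<and> inner_v n g \<eta> x \<iota> t \<in> V"
  using assms(1)
proof (induction t)
  case (Suc t)
  then have IH: "inner_w n g \<eta> x \<iota> t \<in> V" "inner_v n g \<eta> x \<iota> t \<in> V" by auto
  have i: "\<iota> (Suc t) \<in> {1..n}" using Suc.prems by auto
  have w: "inner_w n g \<eta> x \<iota> (Suc t) \<in> V"
    using IH V by (simp add: subspace_diff subspace_scale)
  then have "inner_v n g \<eta> x \<iota> (Suc t) \<in> V"
    unfolding inner_v.simps using IH i V by (intro subspace_add subspace_diff g)
  with w show ?case by blast
qed (use assms G_in_V in simp)

lemma outer_in_V:
  assumes \<sigma>: "\<sigma> \<in> set_pmf (sarah_samples n m S)" and "s \<le> S"
  shows "sarah_outer n g \<eta> m w0 \<sigma> s \<in> V"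
  using assms(2)
proof (induction s)
  case (Suc s)
  then have "sarah_outer n g \<eta> m w0 \<sigma> s \<in> V" by simp
  \<comment> \<open>Step \<open>m + 1\<close> of \<open>inner_w\<close> uses the estimator of step
    \<open>m\<close> only, so all indices involved are sampled ones. Beyond \<open>m\<close> they
    take the default 0, which is not a component index.\<close>
  then have "inner_w n g \<eta> (sarah_outer n g \<eta> m w0 \<sigma> s) (\<lambda>t. \<sigma> (Suc s, t)) m \<in> V \<and>
      inner_v n g \<eta> (sarah_outer n g \<eta> m w0 \<sigma> s) (\<lambda>t. \<sigma> (Suc s, t)) m \<in> V"
    using set_sarah_samplesD[OF n \<sigma>] Suc.prems by (intro inner_in_V) auto
  then show ?case using V by (simp add: subspace_diff subspace_scale)
qed (use w0 in simp)

lemma iterates_in_V: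
  assumes "\<sigma> \<in> set_pmf (sarah_samples n m S)" "s \<in> {1..S}" "t \<le> m"
  shows "w \<sigma> s t \<in> V" "v \<sigma> s t \<in> V"
proof -
  have "sarah_outer n g \<eta> m w0 \<sigma> (s - 1) \<in> V" using assms by (intro outer_in_V) auto
  from inner_in_V[OF _ this, of t "\<lambda>t. \<sigma> (s, t)"] set_sarah_samplesD[OF n assms(1,2)] assms(3)
  show "w \<sigma> s t \<in> V" "v \<sigma> s t \<in> V" by (auto simp: sarah_w_def sarah_v_def)
qed

lemma w_Suc: "w \<sigma> s (Suc t) = w \<sigma> s t - \<eta> *\<^sub>R v \<sigma> s t"
  by (simp add: sarah_w_def sarah_v_def)

lemma v_Suc: "v \<sigma> s (Suc t) =
    g (\<sigma> (s, Suc t)) (w \<sigma> s (Suc t)) - g (\<sigma> (s, Suc t)) (w \<sigma> s t) + v \<sigma> s t"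
  unfolding sarah_w_def sarah_v_def by (rule inner_v.simps(2))

text \<open>Polarization rewrites \<open>y \<bullet> G x\<close> as half of the squared norms of
  \<open>y\<close> and \<open>G x\<close> minus that of \<open>y - G x\<close>.\<close>

lemma descent_step:
  assumes x: "x \<in> V" and y: "y \<in> V" and u: "u = x - \<eta> *\<^sub>R y"
  shows "F u \<le> F x - \<eta> / 2 * (norm (G x))\<^sup>2 + \<eta> / 2 * (norm (y - G x))\<^sup>2
    - \<eta> / 2 * (1 - L * \<eta>) * (norm y)\<^sup>2"
proof -
  have "u \<in> V" using x y V by (simp add: u subspace_diff subspace_scale)
  from descent[OF x this]
  have "F u \<le> F x - \<eta> * (y \<bullet> G x) + L / 2 * (\<eta>\<^sup>2 * (norm y)\<^sup>2)"
    by (simp add: u power_mult_distrib)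
  also have "\<dots> = F x - \<eta> / 2 * (norm (G x))\<^sup>2 + \<eta> / 2 * (norm (y - G x))\<^sup>2
      - \<eta> / 2 * (1 - L * \<eta>) * (norm y)\<^sup>2"
    unfolding power2_norm_eq_inner
    by (simp add: inner_diff_left inner_diff_right inner_commute[of "G x" y]
        power2_eq_square field_simps)
  finally show ?thesis .
qed

text \<open>The new error is \<open>e + \<xi> i\<close> minus the mean of \<open>\<xi>\<close>, with
  \<open>e = y - G x\<close> the old error and \<open>\<xi> i = g i u - g i x\<close>. Average
  smoothness bounds the second moment of \<open>\<xi>\<close>.\<close>

lemma variance_step:
  assumes x: "x \<in> V" and y: "y \<in> V" and u: "u = x - \<eta> *\<^sub>R y"
  shows "(\<Sum>i=1..n. (norm (g i u - g i x + y - G u))\<^sup>2) / real n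
    \<le> (norm (y - G x))\<^sup>2 + L\<^sup>2 * \<eta>\<^sup>2 * (norm y)\<^sup>2"
proof -
  have uV: "u \<in> V" using x y V by (simp add: u subspace_diff subspace_scale)
  have avg: "(1 / real n) *\<^sub>R (\<Sum>i=1..n. g i u - g i x) = G u - G x"
    by (simp add: average_def sum_subtractf scaleR_diff_right)
  have "(\<Sum>i=1..n. (norm (g i u - g i x + y - G u))\<^sup>2) / real n
      \<le> (norm (y - G x))\<^sup>2 + (\<Sum>i=1..n. (norm (g i u - g i x))\<^sup>2) / real n"
    using average_variance_le[OF n, of "y - G x" "\<lambda>i. g i u - g i x"]
    unfolding avg by (simp add: algebra_simps)
  also have "(\<Sum>i=1..n. (norm (g i u - g i x))\<^sup>2) / real n \<le> L\<^sup>2 * (norm (u - x))\<^sup>2"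
    using smooth[OF uV x] by simp
  finally show ?thesis by (simp add: u power_mult_distrib)
qed

text \<open>The weight counts the steps still to come, the current one included: in each of them the
  present error may cost \<open>\<eta> / 2\<close> times its square.\<close>

definition potential :: "nat \<Rightarrow> nat \<Rightarrow> (nat \<times> nat \<Rightarrow> nat) \<Rightarrow> real" where
  "potential s t \<sigma> = F (w \<sigma> s t)
     + \<eta> / 2 * (real (m + 1) - real t) * (norm (v \<sigma> s t - G (w \<sigma> s t)))\<^sup>2"

lemma potential_resample:
  assumes \<sigma>: "\<sigma> \<in> set_pmf (sarah_samples n m S)" and s: "s \<in> {1..S}" and t: "t \<le> m"
  shows "(\<Sum>i=1..n. potential s (Suc t) (\<sigma>((s, Suc t) := i))) / real n
    \<le> potential s t \<sigma> - \<eta> / 2 * (norm (G (w \<sigma> s t)))\<^sup>2"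
proof -
  define x y u where "x = w \<sigma> s t" and "y = v \<sigma> s t" and "u = x - \<eta> *\<^sub>R y"
  define a where "a = \<eta> / 2 * (real m - real t)"
  have xy: "x \<in> V" "y \<in> V" using iterates_in_V[OF assms] by (simp_all add: x_def y_def)
  have a: "a \<ge> 0" using \<eta> t by (simp add: a_def)
  \<comment> \<open>At most \<open>m\<close> steps remain after this one, so the weighted error
    growth is covered by the gain from \<open>descent_step\<close>.\<close>
  have "a * (L\<^sup>2 * \<eta>\<^sup>2) \<le> \<eta> / 2 * (real m * (L\<^sup>2 * \<eta>\<^sup>2))"
    unfolding a_def mult.assoc using \<eta> by (intro mult_left_mono mult_right_mono) auto
  also have "\<dots> \<le> \<eta> / 2 * (1 - L * \<eta>)"
    using step_size \<eta> by (intro mult_left_mono) auto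
  finally have aL: "a * (L\<^sup>2 * \<eta>\<^sup>2) * (norm y)\<^sup>2 \<le> \<eta> / 2 * (1 - L * \<eta>) * (norm y)\<^sup>2"
    by (rule mult_right_mono) simp
  \<comment> \<open>The redrawn index affects only the new estimator; the new point \<open>u\<close>
    is already determined by the past.\<close>
  have "potential s (Suc t) (\<sigma>((s, Suc t) := i))
      = F u + a * (norm (g i u - g i x + y - G u))\<^sup>2" for i
    using s unfolding potential_def
    by (simp add: w_Suc v_Suc sarah_fun_upd x_def y_def u_def a_def)
  then have "(\<Sum>i=1..n. potential s (Suc t) (\<sigma>((s, Suc t) := i))) / real n
      = F u + a * ((\<Sum>i=1..n. (norm (g i u - g i x + y - G u))\<^sup>2) / real n)"
    using n by (simp add: sum.distrib sum_distrib_left[symmetric] add_divide_distrib)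
  also have "\<dots> \<le> F u + a * ((norm (y - G x))\<^sup>2 + L\<^sup>2 * \<eta>\<^sup>2 * (norm y)\<^sup>2)"
    using variance_step[OF xy u_def] a by (intro add_left_mono mult_left_mono)
  \<comment> \<open>The weight \<open>a\<close> plus the \<open>\<eta> / 2\<close> from the descent
    step is exactly the weight at time \<open>t\<close>.\<close>
  also have "\<dots> \<le> F x - \<eta> / 2 * (norm (G x))\<^sup>2 + (\<eta> / 2 + a) * (norm (y - G x))\<^sup>2"
    using descent_step[OF xy u_def] aL
    unfolding distrib_left[of a] distrib_right mult.assoc by linarith
  also have "\<dots> = potential s t \<sigma> - \<eta> / 2 * (norm (G (w \<sigma> s t)))\<^sup>2"
    by (simp add: potential_def x_def y_def a_def field_simps)
  finally show ?thesis .
qed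

lemma expectation_potential_step:
  assumes s: "s \<in> {1..S}" and t: "t \<le> m"
  shows "E (potential s (Suc t)) \<le> E (potential s t) - \<eta> / 2 * E (\<lambda>\<sigma>. (norm (G (w \<sigma> s t)))\<^sup>2)"
proof -
  have "E (potential s (Suc t))
      = E (\<lambda>\<sigma>. (\<Sum>i=1..n. potential s (Suc t) (\<sigma>((s, Suc t) := i))) / real n)"
  proof (cases "t < m")
    case True
    then show ?thesis using n s by (intro expectation_sarah_samples_resample) auto
  next
    case False \<comment> \<open>no index is sampled in step \<open>m + 1\<close>, but there the weight of the error term vanishes\<close>
    with t have "t = m" by simp
    then have "potential s (Suc t) (\<sigma>((s, Suc t) := i)) = potential s (Suc t) \<sigma>" for \<sigma> i
      using s by (simp add: potential_def w_Suc sarah_fun_upd)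
    then show ?thesis using n by simp
  qed
  also have "\<dots> \<le> E (\<lambda>\<sigma>. potential s t \<sigma> - \<eta> / 2 * (norm (G (w \<sigma> s t)))\<^sup>2)"
    by (intro expectation_sarah_samples_mono n potential_resample s t)
  also have "\<dots> = E (potential s t) - \<eta> / 2 * E (\<lambda>\<sigma>. (norm (G (w \<sigma> s t)))\<^sup>2)"
    using n by (subst Bochner_Integration.integral_diff) auto
  finally show ?thesis .
qed

lemma expectation_outer_step:
  assumes s: "Suc s \<in> {1..S}"
  shows "E (\<lambda>\<sigma>. F (sarah_outer n g \<eta> m w0 \<sigma> (Suc s)))
    \<le> E (\<lambda>\<sigma>. F (sarah_outer n g \<eta> m w0 \<sigma> s))
      - \<eta> / 2 * (\<Sum>t=0..m. E (\<lambda>\<sigma>. (norm (G (w \<sigma> (Suc s) t)))\<^sup>2))"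
proof -
  have "E (potential (Suc s) (Suc k)) \<le> E (potential (Suc s) 0)
      - \<eta> / 2 * (\<Sum>t=0..k. E (\<lambda>\<sigma>. (norm (G (w \<sigma> (Suc s) t)))\<^sup>2))" if "k \<le> m" for k
    using that
  proof (induction k)
    case 0
    then show ?case using expectation_potential_step[OF s, of 0] by simp
  next
    case (Suc k)
    then show ?case using expectation_potential_step[OF s, of "Suc k"]
      by (simp add: distrib_left)
  qed
  \<comment> \<open>At time 0 the estimator is the full gradient, so the error is zero; at time
    \<open>m + 1\<close> the weight is zero.\<close>
  from this[of m] show ?thesis
    by (simp add: potential_def[abs_def] sarah_w_def[of _ _ _ _ _ _ _ 0]
        sarah_v_def[of _ _ _ _ _ _ _ 0] w_Suc sarah_w_def[of _ _ _ _ _ _ _ m]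
        sarah_v_def[of _ _ _ _ _ _ _ m])
qed

lemma sum_expectation_gradient_le:
  assumes lower: "\<And>x. x \<in> V \<Longrightarrow> Fstar \<le> F x"
  shows "\<eta> / 2 * (\<Sum>s=1..S. \<Sum>t=0..m. E (\<lambda>\<sigma>. (norm (G (w \<sigma> s t)))\<^sup>2)) \<le> F w0 - Fstar"
proof -
  have "E (\<lambda>\<sigma>. F (sarah_outer n g \<eta> m w0 \<sigma> k)) \<le> F w0
      - \<eta> / 2 * (\<Sum>s=1..k. \<Sum>t=0..m. E (\<lambda>\<sigma>. (norm (G (w \<sigma> s t)))\<^sup>2))" if "k \<le> S" for k
    using that
  proof (induction k)
    case (Suc k)
    then show ?case using expectation_outer_step[of k] by (simp add: distrib_left)
  qed simp
  from this[of S] have "E (\<lambda>\<sigma>. F (sarah_outer n g \<eta> m w0 \<sigma> S)) \<le> F w0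
      - \<eta> / 2 * (\<Sum>s=1..S. \<Sum>t=0..m. E (\<lambda>\<sigma>. (norm (G (w \<sigma> s t)))\<^sup>2))" by simp
  \<comment> \<open>The telescoped bound is closed by the lower bound at the last outer iterate,
    which lies in \<open>V\<close> for every sample in the support.\<close>
  moreover have "E (\<lambda>_. Fstar) \<le> E (\<lambda>\<sigma>. F (sarah_outer n g \<eta> m w0 \<sigma> S))"
    by (intro expectation_sarah_samples_mono n lower outer_in_V) auto
  ultimately show ?thesis by simp
qed

end

section \<open>Choice of the step size, the number of outer loops and the constants\<close>

theorem corollary2:
  shows "\<exists>(c::real)>0. \<exists>C :: real \<Rightarrow> real \<Rightarrow> real.
    \<forall>(d::nat) (n::nat) (f :: nat \<Rightarrow> fin_seq \<Rightarrow> real) (Fstar::real) (L::real) (w0::fin_seq) (\<epsilon>::real).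
      n \<ge> 1 \<longrightarrow>
      (\<forall>i\<in>{1..n}. f i differentiable_on Rd d) \<longrightarrow>
      (\<forall>w\<in>Rd d. Fstar \<le> average n f w) \<longrightarrow>
      L > 0 \<longrightarrow>
      average_smooth_on (Rd d) n f L \<longrightarrow>
      w0 \<in> Rd d \<longrightarrow>
      \<epsilon> > 0 \<longrightarrow>
      (let m = n; \<eta> = c / (L * sqrt (real (m + 1))) in
        \<exists>S\<ge>1. sarah_accurate (Rd d) n f \<eta> m S w0 \<epsilon> \<and>
          real (sarah_complexity n m S)
            \<le> C L (average n f w0 - Fstar) * max (sqrt (real n) / \<epsilon>) (real n))"
proof -
  have main: "\<exists>S\<ge>1. sarah_accurate (Rd d) n f ((1/2) / (L * sqrt (real (n + 1)))) n S w0 \<epsilon> \<and>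
      real (sarah_complexity n n S)
        \<le> (3 + 12 * L * (average n f w0 - Fstar)) * max (sqrt (real n) / \<epsilon>) (real n)"
    if n: "n \<ge> 1" and diff: "\<And>i. i \<in> {1..n} \<Longrightarrow> f i differentiable_on Rd d"
      and lower: "\<And>w. w \<in> Rd d \<Longrightarrow> Fstar \<le> average n f w" and L: "L > 0"
      and smooth: "average_smooth_on (Rd d) n f L" and w0: "w0 \<in> Rd d" and \<epsilon>: "\<epsilon> > 0"
    for d n f Fstar L w0 \<epsilon>
  proof -
    define V where "V = Rd d"
    have V: "subspace V" by (simp add: V_def subspace_Rd)
    define g where "g i = gradient_on V (f i)" for i
    define G where "G = average n g"
    have g: "g i x \<in> V" "(f i has_derivative (\<lambda>h. h \<bullet> g i x)) (at x within V)"
      if "i \<in> {1..n}" "x \<in> V" for i x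
      using Rd_has_gradient[of x d "f i"] diff[OF that(1)] that(2)
      by (auto simp: g_def V_def differentiable_on_def)
    have G: "(average n f has_derivative (\<lambda>h. h \<bullet> G x)) (at x within V)" "G x \<in> V"
      if "x \<in> V" for x
      unfolding G_def using that V g
      by (auto intro!: average_has_derivative average_in_subspace)
    \<comment> \<open>Accuracy is stated with the gradient of the average, whereas the algorithm
      averages component gradients.\<close>
    have grad: "gradient_on V (average n f) x = G x" if "x \<in> V" for x
      using gradient_on_eqI[OF V that G(2) G(1)] that by blast
    have smooth': "(1 / real n) * (\<Sum>i=1..n. (norm (g i x - g i y))\<^sup>2) \<le> L\<^sup>2 * (norm (x - y))\<^sup>2"
      if "x \<in> V" "y \<in> V" for x y
      using smooth that by (simp add: average_smooth_on_def g_def V_def)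
    have lip: "norm (G x - G y) \<le> L * norm (x - y)" if "x \<in> V" "y \<in> V" for x y
    proof -
      have "(norm (G x - G y))\<^sup>2 = (norm ((1 / real n) *\<^sub>R (\<Sum>i=1..n. g i x - g i y)))\<^sup>2"
        by (simp add: G_def average_def sum_subtractf scaleR_diff_right)
      also have "\<dots> \<le> (L * norm (x - y))\<^sup>2"
        using norm_average_le[of n "\<lambda>i. g i x - g i y"] smooth'[OF that]
        by (simp add: power_mult_distrib)
      finally show ?thesis by (rule power2_le_imp_le) (use L in simp)
    qed
    define q where "q = sqrt (real (n + 1))"
    have q: "q > 0" "q\<^sup>2 = real n + 1" "q \<ge> 1" by (simp_all add: q_def)
    define \<eta> where "\<eta> = (1/2) / (L * q)"
    have \<eta>: "\<eta> > 0" "L * \<eta> = 1 / (2 * q)" using L q by (simp_all add: \<eta>_def)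
    define \<Delta> where "\<Delta> = average n f w0 - Fstar"
    have \<Delta>: "\<Delta> \<ge> 0" using lower[OF w0] by (simp add: \<Delta>_def)
    \<comment> \<open>With this \<open>\<eta>\<close> the telescoped bound is
      \<open>4 * L * q * \<Delta>\<close>; accuracy requires it to be at most
      \<open>\<epsilon> * q\<^sup>2 * S\<close>, that is, \<open>S\<close> at least
      \<open>K\<close>.\<close>
    define K where "K = 4 * L * \<Delta> / (q * \<epsilon>)"
    have K: "K \<ge> 0" using L \<Delta> q \<epsilon> by (simp add: K_def)
    define S where "S = max 1 (nat \<lceil>K\<rceil>)"
    have S: "S \<ge> 1" "K \<le> real S" "real S \<le> 1 + K" using K by (auto simp: S_def) linarith+
    \<comment> \<open>Here the factor 1/2 in \<open>\<eta>\<close> matters: the left side is at most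
      1/4 and \<open>L * \<eta>\<close> at most 1/2.\<close>
    have "real n * (L * \<eta>)\<^sup>2 \<le> 1 - L * \<eta>"
    proof -
      have "real n * (L * \<eta>)\<^sup>2 = real n / (4 * (real n + 1))"
        by (simp add: \<eta> power_divide power_mult_distrib q)
      also have "\<dots> \<le> 1 / 4" by (simp add: divide_simps)
      also have "\<dots> \<le> 1 - 1 / (2 * q)" using q by (simp add: field_simps)
      finally show ?thesis by (simp add: \<eta>)
    qed
    then interpret sarah V n n S "average n f" g L \<eta> w0
      using V n w0 g \<eta>(1) smooth' descent_inequality[OF V _ _ G(1) lip]
      by unfold_locales (auto simp: V_def G_def power_mult_distrib)
    define T where "T = (\<Sum>s=1..S. \<Sum>t=0..n. E (\<lambda>\<sigma>. (norm (G (w \<sigma> s t)))\<^sup>2))"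
    have "\<eta> / 2 * T \<le> \<Delta>"
      using sum_expectation_gradient_le[of Fstar] lower
      by (simp add: T_def \<Delta>_def G_def V_def)
    then have T: "T \<le> 4 * L * q * \<Delta>"
      using L q by (simp add: \<eta>_def field_simps)
    have accurate: "sarah_accurate (Rd d) n f \<eta> n S w0 \<epsilon>"
    proof -
      \<comment> \<open>The integrands are compared only almost surely: the two gradients are known
        to agree on \<open>V\<close>, and the iterates lie in \<open>V\<close> for samples in the
        support.\<close>
      have "E (\<lambda>\<sigma>. (norm (gradient_on V (average n f) (w \<sigma> s t)))\<^sup>2)
          = E (\<lambda>\<sigma>. (norm (G (w \<sigma> s t)))\<^sup>2)" if "s \<in> {1..S}" "t \<in> {0..n}" for s t
        using that iterates_in_V grad
        by (intro integral_cong_AE) (auto simp: AE_measure_pmf_iff)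
      then have "(\<Sum>s=1..S. \<Sum>t=0..n.
          E (\<lambda>\<sigma>. (norm (gradient_on V (average n f) (w \<sigma> s t)))\<^sup>2)) = T"
        by (simp add: T_def)
      moreover have "T \<le> \<epsilon> * (real (n + 1) * real S)"
      proof -
        have "4 * L * q * \<Delta> = \<epsilon> * (q\<^sup>2 * K)"
          using q(1) \<epsilon> by (simp add: K_def power2_eq_square)
        also have "\<dots> \<le> \<epsilon> * (q\<^sup>2 * real S)"
          using S \<epsilon> by (intro mult_left_mono) auto
        finally show ?thesis using T by (simp add: q add.commute)
      qed
      ultimately show ?thesis
        using S n unfolding sarah_accurate_def V_def[symmetric] g_def[symmetric]
        by (simp add: divide_simps mult.commute)
    qed
    have "real (sarah_complexity n n S) = 3 * real n * real S"
      by (simp add: sarah_complexity_def algebra_simps)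
    \<comment> \<open>The 1, from rounding up and from requiring at least one outer loop, yields the
      term of order \<open>n\<close>; \<open>K\<close> yields the term of order
      \<open>sqrt n / \<epsilon>\<close>, because \<open>sqrt n \<le> q\<close>.\<close>
    also have "\<dots> \<le> 3 * real n * (1 + K)"
      using S by (intro mult_left_mono) auto
    also have "\<dots> = 3 * real n + 12 * L * \<Delta> * (real n / (q * \<epsilon>))"
      by (simp add: K_def field_simps)
    also have "\<dots> \<le> 3 * real n + 12 * L * \<Delta> * (sqrt (real n) / \<epsilon>)"
    proof -
      have "real n \<le> sqrt (real n) * q"
        using real_sqrt_le_mono[of "real n" "real (n + 1)"]
        by (metis mult_left_mono of_nat_0_le_iff of_nat_le_iff le_add1 q_def real_sqrt_ge_zero
            real_sqrt_mult_self abs_of_nat)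
      then have "real n / (q * \<epsilon>) \<le> sqrt (real n) / \<epsilon>"
        using q(1) \<epsilon> by (simp add: field_simps)
      then show ?thesis using L \<Delta> by (intro add_left_mono mult_left_mono) auto
    qed
    also have "\<dots> \<le> 3 * max (sqrt (real n) / \<epsilon>) (real n)
        + 12 * L * \<Delta> * max (sqrt (real n) / \<epsilon>) (real n)"
      using L \<Delta> by (intro add_mono mult_left_mono) auto
    finally have "real (sarah_complexity n n S)
        \<le> (3 + 12 * L * \<Delta>) * max (sqrt (real n) / \<epsilon>) (real n)"
      by (simp only: distrib_right)
    then show ?thesis using S(1) accurate unfolding \<Delta>_def \<eta>_def q_def by blast
  qed
  show ?thesis
    unfolding Let_def
    by (intro exI[of _ "1/2 :: real"] exI[of _ "\<lambda>L \<Delta>. 3 + 12 * L * \<Delta>"] conjI allI impI main) auto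
qed

end
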